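(* Let $(X,\mathcal B,m,T)$ be a probability preserving transformation and let $\mathcal C\subset\mathcal B$ be a factor. For any countable measurable partition $P$ of $X$, any sequence $(d_k)_{k\ge1}$ with $d_k>0$, and any sequence of positive integers $n_k\to\infty$, there exist a subsequence $k_\ell\to\infty$ and a random variable $Y$ on $[0,\infty]$ such that $$\frac{\log K_{\mathcal C}(P,n_{k_\ell},\varepsilon)}{d_{k_\ell}}\ \longrightarrow\ Y\quad\text{in distribution as } \ell\to\infty,\ \varepsilon\to0 .$$
   Context: A probability preserving transformation $(X,\mathcal B,m,T)$ is an invertible measure preserving transformation $T$ of a probability space $(X,\mathcal B,m)$; a factor is a $T$-invariant sub-$\sigma$-algebra $\mathcal C\subset\mathcal B$; $m(\cdot\|\mathcal C)$ denotes conditional measure with respect to $\mathcal C$. For a countable measurable partition $P$, $P(z)$ is the element of $P$ containing $z$. For $n\ge1$ define the pseudometric $d_n^{(P)}(x,y):=\frac1n\#\{0\le k\le n-1: P(T^kx)\ne P(T^ky)\}$ and the balls $B(n,P,x,\varepsilon):=\{y\in X: d_n^{(P)}(x,y)\le\varepsilon\}$ (each such ball is a union of elements of $\bigvee_{j=0}^{n-1}T^{-j}P$). For $\varepsilon>0$, the relative complexity is the $\mathcal C$-measurable random variable $$K_{\mathcal C}(P,n,\varepsilon)(x):=\min\Big\{\#F:\ F\subset X,\ m\Big(\bigcup_{z\in F}B(n,P,z,\varepsilon)\,\Big\|\,\mathcal C\Big)(x)>1-\varepsilon\Big\}.$$ Double limits: for random variables $Z_{k,\varepsilon}\ge0$ on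 $(X,\mathcal B,m)$ and a random variable $Y$ on $[0,\infty]$, "$Z_{k,\varepsilon}\to Y$ in distribution as $k\to\infty,\ \varepsilon\to0$" means: for every continuous $g:[0,\infty]\to\mathbb R$, $\lim_{\varepsilon\to0}\limsup_{k\to\infty}|E(g(Z_{k,\varepsilon}))-E(g(Y))|=0$. *)

theory Defs
  imports "HOL-Probability.Probability"
begin

text \<open>The transformation is a genuine bijection of the underlying space (not only modulo
  null sets), measurable in both directions.\<close>

definition ppt :: "'a measure \<Rightarrow> ('a \<Rightarrow> 'a) \<Rightarrow> bool" where
  "ppt M T \<longleftrightarrow> prob_space M \<and> bij_betw T (space M) (space M) \<and>
     T \<in> measurable M M \<and> inv_into (space M) T \<in> measurable M M \<and> distr M M T = M"

text \<open>A sub-\<open>\<sigma>\<close>-algebra is encoded as a measure \<open>C\<close> with \<^term>\<open>subalgebra M C\<close>; only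
  \<^term>\<open>sets C\<close> matters. Since the transformation is invertible, invariance is the equality
  of the \<open>\<sigma>\<close>-algebra with its pullback.\<close>

definition factor :: "'a measure \<Rightarrow> ('a \<Rightarrow> 'a) \<Rightarrow> 'a measure \<Rightarrow> bool" where
  "factor M T C \<longleftrightarrow> subalgebra M C \<and> (\<lambda>A. T -` A \<inter> space M) ` sets C = sets C"

definition countable_measurable_partition :: "'a measure \<Rightarrow> 'a set set \<Rightarrow> bool" where
  "countable_measurable_partition M P \<longleftrightarrow> countable P \<and> P \<subseteq> sets M \<and> partition_on (space M) P"

definition cell :: "'a set set \<Rightarrow> 'a \<Rightarrow> 'a set" where
  "cell P z = (THE A. A \<in> P \<and> z \<in> A)"

definition dyn_dist :: "('a \<Rightarrow> 'a) \<Rightarrow> 'a set set \<Rightarrow> nat \<Rightarrow> 'a \<Rightarrow> 'a \<Rightarrow> real" where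
  "dyn_dist T P n x y =
     real (card {k. k < n \<and> cell P ((T ^^ k) x) \<noteq> cell P ((T ^^ k) y)}) / real n"

definition dyn_ball ::
    "'a measure \<Rightarrow> ('a \<Rightarrow> 'a) \<Rightarrow> nat \<Rightarrow> 'a set set \<Rightarrow> 'a \<Rightarrow> real \<Rightarrow> 'a set" where
  "dyn_ball M T n P x \<epsilon> = {y \<in> space M. dyn_dist T P n x y \<le> \<epsilon>}"

definition cond_measure :: "'a measure \<Rightarrow> 'a measure \<Rightarrow> 'a set \<Rightarrow> 'a \<Rightarrow> real" where
  "cond_measure M C A = real_cond_exp M C (indicator A)"

text \<open>Infinite sets \<open>F\<close> have cardinality \<open>\<infinity>\<close> and hence do not affect the infimum. It is
  attained whenever it is finite; the value is \<open>\<infinity>\<close> if no finite \<open>F\<close> qualifies, which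
  for \<open>\<epsilon> > 0\<close> and \<open>n \<ge> 1\<close> happens only on a null set. For each \<open>n\<close>, \<open>\<epsilon>\<close>
  only countably many distinct unions of finitely many balls occur, so the choice of versions of
  the conditional measures affects the value only on a null set.\<close>

definition rel_complexity ::
    "'a measure \<Rightarrow> ('a \<Rightarrow> 'a) \<Rightarrow> 'a measure \<Rightarrow> 'a set set \<Rightarrow> nat \<Rightarrow> real \<Rightarrow> 'a \<Rightarrow> enat" where
  "rel_complexity M T C P n \<epsilon> x =
     (INF F \<in> {F. finite F \<and> F \<subseteq> space M \<and>
                 cond_measure M C (\<Union>z\<in>F. dyn_ball M T n P z \<epsilon>) x > 1 - \<epsilon>}. enat (card F))"

text \<open>The value at \<open>0\<close> is \<open>0\<close>. For \<open>\<epsilon> < 1\<close> the relative complexity is at least \<open>1\<close>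
  almost everywhere.\<close>

definition log_enat :: "enat \<Rightarrow> ennreal" where
  "log_enat N = (case N of enat j \<Rightarrow> ennreal (ln (real j)) | \<infinity> \<Rightarrow> \<infinity>)"

definition double_conv_in_distribution ::
    "'a measure \<Rightarrow> (nat \<Rightarrow> real \<Rightarrow> 'a \<Rightarrow> ennreal) \<Rightarrow> 'b measure \<Rightarrow> ('b \<Rightarrow> ennreal) \<Rightarrow> bool" where
  "double_conv_in_distribution M Z N Y \<longleftrightarrow>
     (\<forall>k. \<forall>\<epsilon>>0. Z k \<epsilon> \<in> borel_measurable M) \<and> Y \<in> borel_measurable N \<and>
     (\<forall>g :: ennreal \<Rightarrow> real. continuous_on UNIV g \<longrightarrow>
        ((\<lambda>\<epsilon>. limsup (\<lambda>k. ereal \<bar>(\<integral>x. g (Z k \<epsilon> x) \<partial>M) - (\<integral>y. g (Y y) \<partial>N)\<bar>)) \<longlongrightarrow> 0)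
          (at_right 0))"

end

theory Submission
  imports Defs "HOL-Complex_Analysis.Great_Picard"
begin

text \<open>
  The double limit exists along a subsequence because of two facts: the relative complexity is
  almost everywhere nonincreasing in \<open>\<epsilon>\<close>, and \<open>[0,\<infinity>]\<close> is compact. Compactness and a diagonal
  argument handle the countably many scales \<open>\<epsilon> = 1/(q+1)\<close>; monotonicity gives the limit as
  \<open>q \<rightarrow> \<infinity>\<close> and controls all the scales in between.

  To turn this into statements about real numbers, the half-line \<open>[0,\<infinity>]\<close> is identified with
  \<open>[0,1]\<close> through \<open>t \<mapsto> 1/(1+t)\<close>. The transformed variables \<open>W k \<epsilon>\<close> increase with \<open>\<epsilon>\<close>, hence so do
  all their moments \<open>E (W k \<epsilon> ^ j)\<close>. One subsequence makes these moments converge for every \<open>j\<close> and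
  every scale \<open>1/(q+1)\<close>; their limits are monotone in \<open>q\<close>, so they converge, and sandwiching
  an arbitrary \<open>\<epsilon>\<close> between two such scales shows that every moment has a double limit
  (\<open>monotone_iterated_limit\<close>). The limits are the moments of a law on \<open>[0,1]\<close>, by Helly's selection
  theorem (\<open>unit_interval_law_from_moments\<close>), and convergence of moments gives convergence for all
  continuous test functions, by Weierstrass approximation (\<open>moments_determine_limits\<close>). The role of
  the moments is that they are test functions which are monotone and yet span a dense space.

  For the complexity itself, what needs an argument is measurability and almost sure monotonicity,
  since conditional measures are only determined up to null sets while the centres range over
  an uncountable space. A ball depends only on the itinerary of its centre through the countable
  partition, so countably many centres suffice (\<open>countable_representatives\<close>), and the exceptional
  null sets can be collected into one.
\<close>

section \<open>The double limit as a filter\<close>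

text \<open>How large \<open>l\<close> must be may depend on \<open>\<epsilon>\<close>, so this is not the product of the two filters.
  Phrasing the double limit as a filter makes the limit calculus for sums and products
  apply to it.\<close>

definition iterated_filter :: "(nat \<times> real) filter" where
  "iterated_filter = Abs_filter (\<lambda>Q. \<forall>\<^sub>F \<epsilon> in at_right 0. \<forall>\<^sub>F l in sequentially. Q (l, \<epsilon>))"

lemma eventually_iterated_filter:
  "eventually Q iterated_filter \<longleftrightarrow> (\<forall>\<^sub>F \<epsilon> in at_right 0. \<forall>\<^sub>F l in sequentially. Q (l, \<epsilon>))"
  unfolding iterated_filter_def
proof (rule eventually_Abs_filter, rule is_filter.intro)
  fix Q R :: "nat \<times> real \<Rightarrow> bool"
  assume "\<forall>\<^sub>F \<epsilon> in at_right 0. \<forall>\<^sub>F l in sequentially. Q (l, \<epsilon>)"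
    "\<forall>\<^sub>F \<epsilon> in at_right 0. \<forall>\<^sub>F l in sequentially. R (l, \<epsilon>)"
  then show "\<forall>\<^sub>F \<epsilon> in at_right 0. \<forall>\<^sub>F l in sequentially. Q (l, \<epsilon>) \<and> R (l, \<epsilon>)"
    by eventually_elim (rule eventually_conj)
next
  fix Q R :: "nat \<times> real \<Rightarrow> bool"
  assume "\<forall>p. Q p \<longrightarrow> R p" "\<forall>\<^sub>F \<epsilon> in at_right 0. \<forall>\<^sub>F l in sequentially. Q (l, \<epsilon>)"
  then show "\<forall>\<^sub>F \<epsilon> in at_right 0. \<forall>\<^sub>F l in sequentially. R (l, \<epsilon>)"
    by (auto elim!: eventually_mono)
qed simp

lemma iterated_filter_neq_bot: "iterated_filter \<noteq> bot"
  using trivial_limit_at_right_real[of "0::real"]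
  by (simp add: trivial_limit_def eventually_iterated_filter)

lemma eventually_iterated_filter_pos: "\<forall>\<^sub>F p in iterated_filter. snd p > 0"
  by (simp add: eventually_iterated_filter eventually_at_right_less)

lemma iterated_limit_imp_limsup_tendsto:
  fixes u :: "nat \<Rightarrow> real \<Rightarrow> real"
  assumes "((\<lambda>(l, \<epsilon>). u l \<epsilon>) \<longlongrightarrow> L) iterated_filter"
  shows "((\<lambda>\<epsilon>. limsup (\<lambda>l. ereal \<bar>u l \<epsilon> - L\<bar>)) \<longlongrightarrow> 0) (at_right 0)"
proof (rule order_tendstoI)
  fix a :: ereal assume "a < 0"
  also have "0 \<le> limsup (\<lambda>l. ereal \<bar>u l \<epsilon> - L\<bar>)" for \<epsilon>
    by (intro le_Limsup) auto
  finally show "\<forall>\<^sub>F \<epsilon> in at_right 0. a < limsup (\<lambda>l. ereal \<bar>u l \<epsilon> - L\<bar>)" by simp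
next
  fix a :: ereal assume "0 < a"
  then obtain \<delta> where \<delta>: "0 < \<delta>" "ereal \<delta> < a"
    using ereal_dense2[of 0 a] by auto
  have "\<forall>\<^sub>F \<epsilon> in at_right 0. \<forall>\<^sub>F l in sequentially. \<bar>u l \<epsilon> - L\<bar> < \<delta>"
    using tendstoD[OF assms \<open>0 < \<delta>\<close>]
    by (simp add: eventually_iterated_filter dist_real_def)
  then show "\<forall>\<^sub>F \<epsilon> in at_right 0. limsup (\<lambda>l. ereal \<bar>u l \<epsilon> - L\<bar>) < a"
  proof eventually_elim
    case (elim \<epsilon>)
    have "limsup (\<lambda>l. ereal \<bar>u l \<epsilon> - L\<bar>) \<le> ereal \<delta>"
      using elim by (intro Limsup_bounded) (auto elim: eventually_mono)
    with \<delta> show ?case by simp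
  qed
qed

text \<open>Convergence at countably many scales \<open>e q\<close> suffices: for \<open>\<epsilon>\<close> between \<open>e q'\<close> and \<open>e q\<close> the
  value \<open>u l \<epsilon>\<close> is squeezed between two sequences whose limits are both close to the
  limit \<open>L\<close> of the decreasing sequence of limits.\<close>

lemma monotone_iterated_limit:
  fixes u :: "nat \<Rightarrow> real \<Rightarrow> real" and e :: "nat \<Rightarrow> real"
  assumes mono: "\<And>l \<epsilon> \<epsilon>'. 0 < \<epsilon> \<Longrightarrow> \<epsilon> \<le> \<epsilon>' \<Longrightarrow> u l \<epsilon> \<le> u l \<epsilon>'"
    and lower: "\<And>l \<epsilon>. 0 < \<epsilon> \<Longrightarrow> B \<le> u l \<epsilon>"
    and e: "\<And>q. 0 < e q" "decseq e" "e \<longlonglongrightarrow> 0"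
    and conv: "\<And>q. convergent (\<lambda>l. u l (e q))"
  obtains L where "((\<lambda>(l, \<epsilon>). u l \<epsilon>) \<longlongrightarrow> L) iterated_filter"
proof -
  obtain b where b: "\<And>q. (\<lambda>l. u l (e q)) \<longlonglongrightarrow> b q"
    using conv unfolding convergent_def by metis
  have "decseq b"
    using b mono e unfolding decseq_def by (meson LIMSEQ_le)
  moreover have "B \<le> b q" for q
    using b[of q] lower[OF e(1)] by (meson LIMSEQ_le_const)
  ultimately obtain L where L: "b \<longlonglongrightarrow> L" "\<And>q. L \<le> b q"
    using decseq_convergent by metis
  have "((\<lambda>(l, \<epsilon>). u l \<epsilon>) \<longlongrightarrow> L) iterated_filter"
  proof (rule tendstoI)
    fix \<delta> :: real assume "\<delta> > 0"
    then obtain q where q: "b q < L + \<delta>"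
      using order_tendstoD(2)[OF L(1), of "L + \<delta>"] eventually_happens' by force
    have "\<forall>\<^sub>F \<epsilon> in at_right 0. 0 < \<epsilon> \<and> \<epsilon> < e q"
      using e(1) eventually_at_right_real[of 0 "e q"] by auto
    then have "\<forall>\<^sub>F \<epsilon> in at_right 0. \<forall>\<^sub>F l in sequentially. \<bar>u l \<epsilon> - L\<bar> < \<delta>"
    proof eventually_elim
      case (elim \<epsilon>)
      then obtain q' where q': "e q' < \<epsilon>"
        using order_tendstoD(2)[OF e(3), of \<epsilon>] eventually_happens' by force
      have "\<forall>\<^sub>F l in sequentially. u l (e q) < L + \<delta>"
        using order_tendstoD(2)[OF b q] .
      moreover have "\<forall>\<^sub>F l in sequentially. L - \<delta> < u l (e q')"
        using \<open>\<delta> > 0\<close> L(2)[of q'] by (intro order_tendstoD(1)[OF b]) auto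
      ultimately show ?case
      proof eventually_elim
        case (elim l)
        then show ?case
          using mono[of "e q'" \<epsilon> l] mono[of \<epsilon> "e q" l] q' e(1)[of q'] \<open>0 < \<epsilon> \<and> \<epsilon> < e q\<close>
          by linarith
      qed
    qed
    then show "\<forall>\<^sub>F p in iterated_filter. dist (case p of (l, \<epsilon>) \<Rightarrow> u l \<epsilon>) L < \<delta>"
      by (simp add: eventually_iterated_filter dist_real_def)
  qed
  then show ?thesis using that by blast
qed

section \<open>Laws on the unit interval\<close>

text \<open>Clamping to \<open>[0,1]\<close> extends a continuous function on the interval to a bounded continuous
  function on the line, as weak convergence requires; integrating \<open>f (unit_clamp t)\<close> against \<open>\<nu>\<close> means
  integrating \<open>f\<close> against the image of \<open>\<nu>\<close>, a law on \<open>[0,1]\<close>.\<close>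

definition unit_clamp :: "real \<Rightarrow> real" where
  "unit_clamp t = max 0 (min 1 t)"

lemma unit_clamp_in: "unit_clamp t \<in> {0..1}"
  by (auto simp: unit_clamp_def)

lemma unit_clamp_id: "t \<in> {0..1} \<Longrightarrow> unit_clamp t = t"
  by (auto simp: unit_clamp_def)

lemma continuous_on_unit_clamp: "continuous_on UNIV unit_clamp"
  unfolding unit_clamp_def by (intro continuous_intros)

lemma unit_clamp_measurable [measurable]: "unit_clamp \<in> borel_measurable borel"
  by (intro borel_measurable_continuous_onI continuous_on_unit_clamp)

lemma continuous_compose_unit_clamp:
  fixes f :: "real \<Rightarrow> real"
  assumes "continuous_on {0..1} f"
  shows "continuous_on UNIV (\<lambda>t. f (unit_clamp t))"
  by (rule continuous_on_compose2[OF assms continuous_on_unit_clamp]) (use unit_clamp_in in auto)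

lemma bounded_compose_unit_clamp:
  fixes f :: "real \<Rightarrow> real"
  assumes "continuous_on {0..1} f"
  shows "\<exists>B. \<forall>t. \<bar>f (unit_clamp t)\<bar> \<le> B"
proof -
  have "bounded (f ` {0..1})"
    by (intro compact_imp_bounded compact_continuous_image assms) simp
  then obtain B where "\<And>y. y \<in> f ` {0..1} \<Longrightarrow> \<bar>y\<bar> \<le> B"
    unfolding bounded_iff by auto
  then show ?thesis using unit_clamp_in by blast
qed

text \<open>If the moments of \<open>[0,1]\<close>-valued variables converge along a filter, a sequence of these
  variables can be chosen whose first \<open>m\<close> moments are within \<open>1/(m+1)\<close> of the limits. The laws of this
  sequence are tight, and any weak limit point has the prescribed moments.\<close>

lemma unit_interval_law_from_moments:
  fixes X :: "'i \<Rightarrow> 'a \<Rightarrow> real" and F :: "'i filter" and a :: "nat \<Rightarrow> real"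
  assumes M: "prob_space M" and F: "F \<noteq> bot"
    and X: "\<forall>\<^sub>F p in F. X p \<in> borel_measurable M \<and> (\<forall>x. X p x \<in> {0..1})"
    and mom: "\<And>j. ((\<lambda>p. \<integral>x. X p x ^ j \<partial>M) \<longlongrightarrow> a j) F"
  obtains \<nu> where "real_distribution \<nu>" "\<And>j. (\<integral>t. unit_clamp t ^ j \<partial>\<nu>) = a j"
proof -
  interpret prob_space M by (rule M)
  have "\<exists>p. (X p \<in> borel_measurable M \<and> (\<forall>x. X p x \<in> {0..1})) \<and>
      (\<forall>j\<in>{..m}. dist (\<integral>x. X p x ^ j \<partial>M) (a j) < inverse (real (Suc m)))" for m
  proof -
    have "\<forall>\<^sub>F p in F. (X p \<in> borel_measurable M \<and> (\<forall>x. X p x \<in> {0..1})) \<and>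
      (\<forall>j\<in>{..m}. dist (\<integral>x. X p x ^ j \<partial>M) (a j) < inverse (real (Suc m)))"
      by (intro eventually_conj X eventually_ball_finite ballI tendstoD[OF mom]) auto
    then show ?thesis by (rule eventually_happens'[OF F])
  qed
  then obtain p where p: "\<And>m. X (p m) \<in> borel_measurable M" "\<And>m x. X (p m) x \<in> {0..1}"
    and near: "\<And>m j. j \<le> m \<Longrightarrow> dist (\<integral>x. X (p m) x ^ j \<partial>M) (a j) < inverse (real (Suc m))"
    by (metis atMost_iff)
  note p(1)[measurable]
  define \<mu> where "\<mu> m = distr M borel (X (p m))" for m
  have dist_\<mu>: "real_distribution (\<mu> m)" for m
    unfolding \<mu>_def by (intro real_distribution_distr) simp
  have "tight \<mu>"
    unfolding tight_def
  proof (intro conjI allI impI dist_\<mu>)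
    fix \<delta> :: real assume "\<delta> > 0"
    \<comment> \<open>tightness is tested on left-open intervals, so the left end point must lie below \<open>0\<close>\<close>
    have "measure (\<mu> m) {-1<..1} = 1" for m
    proof -
      have "X (p m) -` {-1<..1} \<inter> space M = space M"
        using p(2)[of m] by (force simp: less_le_trans[of "-1" 0])
      then show ?thesis by (simp add: \<mu>_def measure_distr prob_space)
    qed
    with \<open>\<delta> > 0\<close> show "\<exists>a b. a < b \<and> (\<forall>m. 1 - \<delta> < measure (\<mu> m) {a<..b})"
      by (intro exI[of _ "-1"] exI[of _ 1]) auto
  qed
  from tight_imp_convergent_subsubsequence[OF this strict_mono_id]
  obtain r \<nu> where r: "strict_mono r" and \<nu>: "real_distribution \<nu>"
    and weak: "weak_conv_m (\<mu> \<circ> id \<circ> r) \<nu>" by blast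
  interpret \<nu>: real_distribution \<nu> by (rule \<nu>)
  have "(\<integral>t. unit_clamp t ^ j \<partial>\<nu>) = a j" for j
  proof (rule LIMSEQ_unique)
    have "(\<lambda>i. \<integral>t. unit_clamp t ^ j \<partial>(\<mu> \<circ> id \<circ> r) i) \<longlonglongrightarrow> (\<integral>t. unit_clamp t ^ j \<partial>\<nu>)"
    proof (rule weak_conv_imp_integral_bdd_continuous_conv[OF _ _ weak, where B = 1])
      show "isCont (\<lambda>t. unit_clamp t ^ j) t" for t
        using continuous_on_unit_clamp
        by (intro isCont_power) (simp add: continuous_on_eq_continuous_at)
      show "norm (unit_clamp t ^ j) \<le> 1" for t
        using unit_clamp_in[of t] by (simp add: power_le_one norm_power)
    qed (use dist_\<mu> \<nu> in auto)
    moreover have "(\<integral>t. unit_clamp t ^ j \<partial>\<mu> m) = (\<integral>x. X (p m) x ^ j \<partial>M)" for m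
      unfolding \<mu>_def using p(2) by (simp add: integral_distr unit_clamp_id)
    ultimately show "(\<lambda>i. \<integral>x. X (p (r i)) x ^ j \<partial>M) \<longlonglongrightarrow> (\<integral>t. unit_clamp t ^ j \<partial>\<nu>)"
      by simp
    have "(\<lambda>m. dist (\<integral>x. X (p m) x ^ j \<partial>M) (a j)) \<longlonglongrightarrow> 0"
    proof (rule tendsto_sandwich[OF _ _ tendsto_const LIMSEQ_inverse_real_of_nat])
      show "\<forall>\<^sub>F m in sequentially. dist (\<integral>x. X (p m) x ^ j \<partial>M) (a j) \<le> inverse (real (Suc m))"
        using near by (intro eventually_sequentiallyI[of j] less_imp_le) auto
    qed simp
    then have "(\<lambda>m. \<integral>x. X (p m) x ^ j \<partial>M) \<longlonglongrightarrow> a j"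
      by (subst tendsto_dist_iff)
    from LIMSEQ_subseq_LIMSEQ[OF this r] show "(\<lambda>i. \<integral>x. X (p (r i)) x ^ j \<partial>M) \<longlonglongrightarrow> a j"
      by (simp add: o_def)
  qed
  with \<nu> show ?thesis using that by blast
qed

text \<open>Linear combinations of moments give all polynomial test functions, and these are uniformly
  dense in the continuous functions on \<open>[0,1]\<close>: an error of \<open>\<delta>/3\<close> on each side of the limit and
  \<open>\<delta>/3\<close> for the polynomial itself.\<close>

lemma moments_determine_limits:
  fixes X :: "'i \<Rightarrow> 'a \<Rightarrow> real" and F :: "'i filter" and f :: "real \<Rightarrow> real"
  assumes M: "prob_space M" and \<nu>: "real_distribution \<nu>"
    and X: "\<forall>\<^sub>F p in F. X p \<in> borel_measurable M \<and> (\<forall>x. X p x \<in> {0..1})"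
    and mom: "\<And>j. ((\<lambda>p. \<integral>x. X p x ^ j \<partial>M) \<longlongrightarrow> (\<integral>t. unit_clamp t ^ j \<partial>\<nu>)) F"
    and f: "continuous_on {0..1} f"
  shows "((\<lambda>p. \<integral>x. f (X p x) \<partial>M) \<longlongrightarrow> (\<integral>t. f (unit_clamp t) \<partial>\<nu>)) F"
proof (rule tendstoI)
  interpret prob_space M by (rule M)
  interpret \<nu>: real_distribution \<nu> by (rule \<nu>)
  have clamp_measurable: "(\<lambda>t. h (unit_clamp t)) \<in> borel_measurable borel"
    if "continuous_on {0..1} h" for h :: "real \<Rightarrow> real"
    by (intro borel_measurable_continuous_onI continuous_compose_unit_clamp that)
  have int\<nu>: "integrable \<nu> (\<lambda>t. h (unit_clamp t))" if h: "continuous_on {0..1} h" for h :: "real \<Rightarrow> real"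
  proof -
    obtain B where "\<And>t. \<bar>h (unit_clamp t)\<bar> \<le> B"
      using bounded_compose_unit_clamp[OF h] by blast
    moreover note clamp_measurable[OF h, measurable]
    ultimately show ?thesis by (intro \<nu>.integrable_const_bound[of _ B]) auto
  qed
  have intX: "integrable M (\<lambda>x. h (X p x))"
    if h: "continuous_on {0..1} h" and p: "X p \<in> borel_measurable M \<and> (\<forall>x. X p x \<in> {0..1})"
    for h :: "real \<Rightarrow> real" and p
  proof -
    obtain B where "\<And>t. \<bar>h (unit_clamp t)\<bar> \<le> B"
      using bounded_compose_unit_clamp[OF h] by blast
    moreover note clamp_measurable[OF h, measurable]
    moreover have [measurable]: "X p \<in> borel_measurable M" using p by simp
    ultimately have "integrable M (\<lambda>x. h (unit_clamp (X p x)))"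
      by (intro integrable_const_bound[of _ B]) auto
    then show ?thesis using p by (simp add: unit_clamp_id)
  qed
  fix \<delta> :: real assume "\<delta> > 0"
  then obtain g where g: "real_polynomial_function g" "\<And>t. t \<in> {0..1} \<Longrightarrow> \<bar>f t - g t\<bar> < \<delta> / 3"
    using Stone_Weierstrass_real_polynomial_function[OF compact_Icc f, of "\<delta> / 3"] by auto
  then obtain c m where gsum: "g = (\<lambda>t. \<Sum>i\<le>m. c i * t ^ i)"
    unfolding real_polynomial_function_iff_sum by auto
  have cont_g: "continuous_on {0..1} g"
    unfolding gsum by (intro continuous_intros)
  have power: "continuous_on {0..1} (\<lambda>t::real. t ^ i)" for i
    by (intro continuous_intros)
  have "((\<lambda>p. \<Sum>i\<le>m. c i * (\<integral>x. X p x ^ i \<partial>M)) \<longlongrightarrow> (\<Sum>i\<le>m. c i * (\<integral>t. unit_clamp t ^ i \<partial>\<nu>))) F"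
    by (intro tendsto_intros mom)
  moreover have "(\<Sum>i\<le>m. c i * (\<integral>t. unit_clamp t ^ i \<partial>\<nu>)) = (\<integral>t. g (unit_clamp t) \<partial>\<nu>)"
    unfolding gsum using int\<nu>[OF power] by (simp add: Bochner_Integration.integral_sum)
  ultimately have "\<forall>\<^sub>F p in F. dist (\<Sum>i\<le>m. c i * (\<integral>x. X p x ^ i \<partial>M)) (\<integral>t. g (unit_clamp t) \<partial>\<nu>) < \<delta> / 3"
    using tendstoD[of _ _ F "\<delta> / 3"] \<open>\<delta> > 0\<close> by auto
  with X show "\<forall>\<^sub>F p in F. dist (\<integral>x. f (X p x) \<partial>M) (\<integral>t. f (unit_clamp t) \<partial>\<nu>) < \<delta>"
  proof eventually_elim
    case (elim p)
    have "(\<Sum>i\<le>m. c i * (\<integral>x. X p x ^ i \<partial>M)) = (\<integral>x. g (X p x) \<partial>M)"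
      unfolding gsum using intX[OF power elim(1)] by (simp add: Bochner_Integration.integral_sum)
    with elim(2) have 1: "\<bar>(\<integral>x. g (X p x) \<partial>M) - (\<integral>t. g (unit_clamp t) \<partial>\<nu>)\<bar> < \<delta> / 3"
      by (simp add: dist_real_def)
    have "\<bar>\<integral>x. f (X p x) - g (X p x) \<partial>M\<bar> \<le> (\<integral>x. \<delta> / 3 \<partial>M)"
      using g(2) elim(1) intX[OF f elim(1)] intX[OF cont_g elim(1)]
      by (intro order_trans[OF integral_abs_bound] integral_mono Bochner_Integration.integrable_abs
          Bochner_Integration.integrable_diff) (auto intro: less_imp_le)
    then have 2: "\<bar>(\<integral>x. f (X p x) \<partial>M) - (\<integral>x. g (X p x) \<partial>M)\<bar> \<le> \<delta> / 3"
      using intX[OF f elim(1)] intX[OF cont_g elim(1)] by (simp add: prob_space)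
    have "\<bar>\<integral>t. f (unit_clamp t) - g (unit_clamp t) \<partial>\<nu>\<bar> \<le> (\<integral>t. \<delta> / 3 \<partial>\<nu>)"
      using g(2) unit_clamp_in int\<nu>[OF f] int\<nu>[OF cont_g]
      by (intro order_trans[OF integral_abs_bound] integral_mono Bochner_Integration.integrable_abs
          Bochner_Integration.integrable_diff) (auto intro: less_imp_le)
    then have 3: "\<bar>(\<integral>t. f (unit_clamp t) \<partial>\<nu>) - (\<integral>t. g (unit_clamp t) \<partial>\<nu>)\<bar> \<le> \<delta> / 3"
      using int\<nu>[OF f] int\<nu>[OF cont_g] \<nu>.prob_space by simp
    from 1 2 3 show ?case unfolding dist_real_def by linarith
  qed
qed

text \<open>The subsequence is the diagonal one for the countable family of moments indexed by
  the exponent \<open>j\<close> and the scale \<open>1/(q+1)\<close>.\<close>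

lemma monotone_family_subsequence:
  fixes W :: "nat \<Rightarrow> real \<Rightarrow> 'a \<Rightarrow> real"
  assumes M: "prob_space M"
    and meas: "\<And>k \<epsilon>. 0 < \<epsilon> \<Longrightarrow> W k \<epsilon> \<in> borel_measurable M"
    and range: "\<And>k \<epsilon> x. W k \<epsilon> x \<in> {0..1}"
    and mono: "\<And>k \<epsilon> \<epsilon>'. 0 < \<epsilon> \<Longrightarrow> \<epsilon> \<le> \<epsilon>' \<Longrightarrow> AE x in M. W k \<epsilon> x \<le> W k \<epsilon>' x"
  shows "\<exists>\<kappa> \<nu>. strict_mono \<kappa> \<and> real_distribution \<nu> \<and>
    (\<forall>f :: real \<Rightarrow> real. continuous_on {0..1} f \<longrightarrow>
       ((\<lambda>(l, \<epsilon>). \<integral>x. f (W (\<kappa> l) \<epsilon> x) \<partial>M) \<longlongrightarrow> (\<integral>t. f (unit_clamp t) \<partial>\<nu>)) iterated_filter)"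
proof -
  interpret prob_space M by (rule M)
  define e :: "nat \<Rightarrow> real" where "e q = inverse (real (Suc q))" for q
  have e: "0 < e q" "decseq e" "e \<longlonglongrightarrow> 0" for q
    unfolding e_def using LIMSEQ_inverse_real_of_nat
    by (auto simp: decseq_def field_simps)
  have int: "integrable M (\<lambda>x. W k \<epsilon> x ^ j)" if "0 < \<epsilon>" for k \<epsilon> j
  proof (rule integrable_const_bound[of _ 1])
    show "AE x in M. norm (W k \<epsilon> x ^ j) \<le> 1"
      using range by (auto simp: power_le_one)
    show "(\<lambda>x. W k \<epsilon> x ^ j) \<in> borel_measurable M"
      using meas[OF that] by simp
  qed
  have bound: "0 \<le> (\<integral>x. W k \<epsilon> x ^ j \<partial>M)" "(\<integral>x. W k \<epsilon> x ^ j \<partial>M) \<le> 1" if "0 < \<epsilon>" for k \<epsilon> j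
  proof -
    show "0 \<le> (\<integral>x. W k \<epsilon> x ^ j \<partial>M)"
      using range by (intro integral_nonneg_AE) auto
    have "(\<integral>x. W k \<epsilon> x ^ j \<partial>M) \<le> (\<integral>x. 1 \<partial>M)"
      using range by (intro integral_mono int that) (auto simp: power_le_one)
    then show "(\<integral>x. W k \<epsilon> x ^ j \<partial>M) \<le> 1" by (simp add: prob_space)
  qed
  have mono_moment: "(\<integral>x. W k \<epsilon> x ^ j \<partial>M) \<le> (\<integral>x. W k \<epsilon>' x ^ j \<partial>M)"
    if "0 < \<epsilon>" "\<epsilon> \<le> \<epsilon>'" for k \<epsilon> \<epsilon>' j
  proof (rule integral_mono_AE[OF int int])
    show "AE x in M. W k \<epsilon> x ^ j \<le> W k \<epsilon>' x ^ j"
      using mono[OF that, of k]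
    proof eventually_elim
      case (elim x)
      then show ?case using range[of k \<epsilon> x] by (simp add: power_mono)
    qed
  qed (use that in auto)
  obtain \<kappa> where \<kappa>: "strict_mono \<kappa>"
    and conv: "\<And>j q. convergent (\<lambda>l. \<integral>x. W (\<kappa> l) (e q) x ^ j \<partial>M)"
  proof -
    define A where "A k jq = (\<integral>x. W k (e (snd jq)) x ^ fst jq \<partial>M)" for k and jq :: "nat \<times> nat"
    have bnd: "norm (A k jq) \<le> 1" for k jq
      unfolding A_def using bound[OF e(1)] by simp
    have "\<exists>\<kappa>. strict_mono \<kappa> \<and> (\<forall>jq. convergent (\<lambda>l. A (\<kappa> l) jq))"
      unfolding convergent_def
      by (rule function_convergent_subsequence[of UNIV A 1]) (rule countableI_type, rule bnd, blast)
    then obtain \<kappa> where \<kappa>: "strict_mono \<kappa>" and conv: "\<And>jq. convergent (\<lambda>l. A (\<kappa> l) jq)"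
      by blast
    have "convergent (\<lambda>l. \<integral>x. W (\<kappa> l) (e q) x ^ j \<partial>M)" for j q
      using conv[of "(j, q)"] by (simp add: A_def)
    with \<kappa> show ?thesis by (rule that)
  qed
  have "\<exists>L. ((\<lambda>(l, \<epsilon>). \<integral>x. W (\<kappa> l) \<epsilon> x ^ j \<partial>M) \<longlongrightarrow> L) iterated_filter" for j
    by (rule monotone_iterated_limit[of "\<lambda>l \<epsilon>. \<integral>x. W (\<kappa> l) \<epsilon> x ^ j \<partial>M" 0 e])
      (use mono_moment bound(1) e conv in auto)
  then obtain a where a: "\<And>j. ((\<lambda>(l, \<epsilon>). \<integral>x. W (\<kappa> l) \<epsilon> x ^ j \<partial>M) \<longlongrightarrow> a j) iterated_filter"
    by metis
  define X where "X = (\<lambda>(l, \<epsilon>). W (\<kappa> l) \<epsilon>)"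
  have X: "\<forall>\<^sub>F p in iterated_filter. X p \<in> borel_measurable M \<and> (\<forall>x. X p x \<in> {0..1})"
    using eventually_iterated_filter_pos
    by eventually_elim (use meas range in \<open>auto simp: X_def split: prod.splits\<close>)
  have mom: "((\<lambda>p. \<integral>x. X p x ^ j \<partial>M) \<longlongrightarrow> a j) iterated_filter" for j
    using a[of j] by (simp add: X_def case_prod_unfold)
  obtain \<nu> where \<nu>: "real_distribution \<nu>" "\<And>j. (\<integral>t. unit_clamp t ^ j \<partial>\<nu>) = a j"
    using unit_interval_law_from_moments[OF M iterated_filter_neq_bot X mom] by blast
  have "((\<lambda>(l, \<epsilon>). \<integral>x. f (W (\<kappa> l) \<epsilon> x) \<partial>M) \<longlongrightarrow> (\<integral>t. f (unit_clamp t) \<partial>\<nu>)) iterated_filter"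
    if "continuous_on {0..1} f" for f :: "real \<Rightarrow> real"
    using moments_determine_limits[OF M \<nu>(1) X _ that] mom \<nu>(2)
    by (simp add: X_def case_prod_unfold)
  with \<kappa> \<nu>(1) show ?thesis by blast
qed

section \<open>From the extended half-line to the unit interval\<close>

text \<open>The order-reversing homeomorphism \<open>t \<mapsto> 1/(1+t)\<close> sends \<open>\<infinity>\<close> to \<open>0\<close>; since \<open>inverse (1 + t) \<le> 1\<close>
  is always finite, the conversion to a real number loses nothing.\<close>

definition to_unit :: "ennreal \<Rightarrow> real" where
  "to_unit t = enn2real (inverse (1 + t))"

text \<open>The inverse homeomorphism \<open>s \<mapsto> 1/s - 1\<close>. The difference is formed in the extended reals,
  where subtracting a finite number is continuous also at \<open>\<infinity>\<close>, that is, at \<open>s = 0\<close>.\<close>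

definition from_unit :: "real \<Rightarrow> ennreal" where
  "from_unit s = e2ennreal (enn2ereal (inverse (ennreal s)) - 1)"

lemma to_unit_ennreal:
  assumes "0 \<le> r" shows "to_unit (ennreal r) = inverse (1 + r)"
proof -
  have "1 + ennreal r = ennreal (1 + r)"
    using assms by (simp add: ennreal_plus)
  then show ?thesis
    using assms by (simp add: to_unit_def inverse_ennreal del: ennreal_plus)
qed

lemma to_unit_top: "to_unit top = 0"
  by (simp add: to_unit_def)

lemma to_unit_in: "to_unit t \<in> {0..1}"
  by (cases t) (auto simp: to_unit_ennreal to_unit_top inverse_le_1_iff)

lemma to_unit_antimono: "s \<le> t \<Longrightarrow> to_unit t \<le> to_unit s"
  by (cases s; cases t) (auto simp: to_unit_ennreal to_unit_top top_unique intro!: le_imp_inverse_le)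

lemma from_unit_to_unit: "from_unit (to_unit t) = t"
proof (cases t)
  case (real r)
  then have "inverse (ennreal (inverse (1 + r))) = ennreal (1 + r)"
    by (simp add: inverse_ennreal del: ennreal_plus)
  then have "from_unit (to_unit t) = e2ennreal (ereal (1 + r) - 1)"
    using real by (simp add: from_unit_def to_unit_ennreal enn2ereal_ennreal del: ennreal_plus)
  then show ?thesis using real by (simp add: one_ereal_def e2ennreal_ereal)
next
  case top
  then show ?thesis by (simp add: from_unit_def to_unit_top e2ennreal_infty)
qed

lemma to_unit_measurable [measurable]: "to_unit \<in> borel_measurable borel"
  unfolding to_unit_def[abs_def] by measurable

lemma continuous_on_from_unit: "continuous_on {0..1} from_unit"
proof -
  have "continuous_on {0..1} (\<lambda>s. enn2ereal (inverse (ennreal s)))"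
    by (rule continuous_on_compose2[OF continuous_on_enn2ereal])
      (auto intro!: continuous_on_inverse_ennreal[OF continuous_on_ennreal[OF continuous_on_id]])
  then have "continuous_on {0..1} (\<lambda>s. enn2ereal (inverse (ennreal s)) - 1)"
    unfolding continuous_on_def by (auto intro!: tendsto_diff_ereal_general tendsto_const)
  then show ?thesis
    unfolding from_unit_def[abs_def]
    by (rule continuous_on_compose2[OF continuous_on_e2ennreal[of UNIV]]) auto
qed

lemma from_unit_measurable [measurable]: "from_unit \<in> borel_measurable borel"
  unfolding from_unit_def[abs_def] by measurable

text \<open>The compactness principle behind the theorem. The limit variable is the identity
  under the law \<open>N\<close> obtained by transporting the limit law on \<open>[0,1]\<close> back to \<open>[0,\<infinity>]\<close>.\<close>

lemma monotone_family_converges_along_subsequence: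
  fixes Z :: "nat \<Rightarrow> real \<Rightarrow> 'a \<Rightarrow> ennreal"
  assumes M: "prob_space M"
    and meas: "\<And>k \<epsilon>. 0 < \<epsilon> \<Longrightarrow> Z k \<epsilon> \<in> borel_measurable M"
    and mono: "\<And>k \<epsilon> \<epsilon>'. 0 < \<epsilon> \<Longrightarrow> \<epsilon> \<le> \<epsilon>' \<Longrightarrow> AE x in M. Z k \<epsilon>' x \<le> Z k \<epsilon> x"
  shows "\<exists>(\<kappa> :: nat \<Rightarrow> nat) (N :: ennreal measure) (Y :: ennreal \<Rightarrow> ennreal).
    strict_mono \<kappa> \<and> prob_space N \<and> double_conv_in_distribution M (\<lambda>l. Z (\<kappa> l)) N Y"
proof -
  define W where "W k \<epsilon> x = to_unit (Z k \<epsilon> x)" for k \<epsilon> x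
  have W: "W k \<epsilon> \<in> borel_measurable M" if "0 < \<epsilon>" for k \<epsilon>
    unfolding W_def[abs_def] using meas[OF that] by measurable
  have W_mono: "AE x in M. W k \<epsilon> x \<le> W k \<epsilon>' x" if "0 < \<epsilon>" "\<epsilon> \<le> \<epsilon>'" for k \<epsilon> \<epsilon>'
    using mono[OF that, of k] by eventually_elim (simp add: W_def to_unit_antimono)
  have W_in: "W k \<epsilon> x \<in> {0..1}" for k \<epsilon> x
    unfolding W_def by (rule to_unit_in)
  obtain \<kappa> \<nu> where \<kappa>: "strict_mono \<kappa>" and \<nu>: "real_distribution \<nu>"
    and lim: "\<And>f :: real \<Rightarrow> real. continuous_on {0..1} f \<Longrightarrow>
       ((\<lambda>(l, \<epsilon>). \<integral>x. f (W (\<kappa> l) \<epsilon> x) \<partial>M) \<longlongrightarrow> (\<integral>t. f (unit_clamp t) \<partial>\<nu>)) iterated_filter"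
    using monotone_family_subsequence[of M W, OF M W W_in W_mono] by blast
  interpret \<nu>: real_distribution \<nu> by (rule \<nu>)
  define N where "N = distr \<nu> borel (\<lambda>t. from_unit (unit_clamp t))"
  have "prob_space N"
    unfolding N_def by (intro \<nu>.prob_space_distr) simp
  moreover have "double_conv_in_distribution M (\<lambda>l. Z (\<kappa> l)) N id"
    unfolding double_conv_in_distribution_def
  proof (intro conjI allI impI)
    show "Z (\<kappa> k) \<epsilon> \<in> borel_measurable M" if "\<epsilon> > 0" for k \<epsilon>
      using meas[OF that] .
    show "id \<in> borel_measurable N" by (simp add: N_def)
    fix g :: "ennreal \<Rightarrow> real" assume g: "continuous_on UNIV g"
    have [measurable]: "g \<in> borel_measurable borel"
      using g by (rule borel_measurable_continuous_onI)
    have "continuous_on {0..1} (\<lambda>s. g (from_unit s))"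
      by (rule continuous_on_compose2[OF g continuous_on_from_unit]) auto
    from lim[OF this]
    have "((\<lambda>(l, \<epsilon>). \<integral>x. g (Z (\<kappa> l) \<epsilon> x) \<partial>M) \<longlongrightarrow> (\<integral>t. g (from_unit (unit_clamp t)) \<partial>\<nu>)) iterated_filter"
      by (simp add: W_def from_unit_to_unit)
    moreover have "(\<integral>t. g (from_unit (unit_clamp t)) \<partial>\<nu>) = (\<integral>y. g (id y) \<partial>N)"
      by (simp add: N_def integral_distr)
    ultimately show "((\<lambda>\<epsilon>. limsup (\<lambda>k. ereal \<bar>(\<integral>x. g (Z (\<kappa> k) \<epsilon> x) \<partial>M) - (\<integral>y. g (id y) \<partial>N)\<bar>)) \<longlongrightarrow> 0)
          (at_right 0)"
      by (intro iterated_limit_imp_limsup_tendsto) simp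
  qed
  ultimately show ?thesis using \<kappa> by blast
qed

section \<open>Relative complexity\<close>

lemma cell_eqI:
  assumes P: "partition_on S P" and A: "A \<in> P" "z \<in> A" shows "cell P z = A"
  unfolding cell_def
proof (rule the_equality)
  fix B assume B: "B \<in> P \<and> z \<in> B"
  show "B = A"
    using disjointD[OF partition_onD2[OF P], of B A] A B by blast
qed (use A in simp)

lemma cell_mem:
  assumes "partition_on S P" "z \<in> S" shows "cell P z \<in> P" "z \<in> cell P z"
proof -
  obtain A where "A \<in> P" "z \<in> A" using assms by (auto simp: partition_on_def)
  with cell_eqI[OF assms(1) this] show "cell P z \<in> P" "z \<in> cell P z" by auto
qed

text \<open>For a fixed centre, the Hamming distance is a finite sum of indicators of the events that the
  orbit of \<open>y\<close> leaves the cell visited by the centre.\<close>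

lemma dyn_ball_measurable:
  assumes T: "T \<in> measurable M M" and P: "countable_measurable_partition M P" and z: "z \<in> space M"
  shows "dyn_ball M T n P z \<epsilon> \<in> sets M"
proof -
  have part: "partition_on (space M) P" "P \<subseteq> sets M"
    using P by (auto simp: countable_measurable_partition_def)
  have Tk: "(T ^^ k) y \<in> space M" if "y \<in> space M" for k y
    using measurable_space[OF measurable_compose_n[OF T] that] .
  define A where "A k = cell P ((T ^^ k) z)" for k
  have A: "A k \<in> P" for k
    unfolding A_def by (rule cell_mem(1)[OF part(1) Tk[OF z]])
  have [measurable]: "A k \<in> sets M" for k using A part(2) by blast
  have [measurable]: "(T ^^ k) \<in> measurable M M" for k by (rule measurable_compose_n[OF T])
  have "dyn_dist T P n z y = (\<Sum>k<n. indicator (space M - A k) ((T ^^ k) y)) / real n"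
    if y: "y \<in> space M" for y
  proof -
    have "A k \<noteq> cell P ((T ^^ k) y) \<longleftrightarrow> (T ^^ k) y \<in> space M - A k" for k
      using cell_eqI[OF part(1) A] cell_mem(2)[OF part(1) Tk[OF y]] Tk[OF y] by auto
    then have "{k. k < n \<and> A k \<noteq> cell P ((T ^^ k) y)} = {..<n} \<inter> {k. (T ^^ k) y \<in> space M - A k}"
      by auto
    then show ?thesis
      unfolding dyn_dist_def A_def[symmetric] by (simp add: indicator_def sum.If_cases)
  qed
  then have "dyn_ball M T n P z \<epsilon> =
      {y \<in> space M. (\<Sum>k<n. indicator (space M - A k) ((T ^^ k) y)) / real n \<le> \<epsilon>}"
    by (auto simp: dyn_ball_def)
  also have "\<dots> \<in> sets M" by measurable
  finally show ?thesis .
qed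

text \<open>The pseudometric depends on its first argument only through its itinerary of
  length \<open>n\<close>, a list over the countable set \<open>P\<close>. The representative does not depend on \<open>\<epsilon>\<close>, which is
  what allows complexities at two different scales to be compared.\<close>

lemma countable_representatives:
  assumes T: "T \<in> measurable M M" and P: "countable_measurable_partition M P"
  obtains S where "countable S" "S \<subseteq> space M"
    "\<And>z. z \<in> space M \<Longrightarrow> \<exists>s\<in>S. \<forall>\<epsilon>. dyn_ball M T n P s \<epsilon> = dyn_ball M T n P z \<epsilon>"
proof -
  define name where "name z = map (\<lambda>k. cell P ((T ^^ k) z)) [0..<n]" for z
  have part: "partition_on (space M) P" "countable P"
    using P by (auto simp: countable_measurable_partition_def)
  have "name ` space M \<subseteq> lists P"
    unfolding name_def
    using cell_mem(1)[OF part(1) measurable_space[OF measurable_compose_n[OF T]]] by auto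
  then have "countable (name ` space M)"
    using countable_lists[OF part(2)] countable_subset by blast
  then obtain S where S: "countable S" "S \<subseteq> space M" "name ` space M = name ` S"
    using countable_subset_image[of "name ` space M" name "space M"] by auto
  have "\<exists>s\<in>S. \<forall>\<epsilon>. dyn_ball M T n P s \<epsilon> = dyn_ball M T n P z \<epsilon>" if z: "z \<in> space M" for z
  proof -
    have "name z \<in> name ` S" using S(3) z by blast
    then obtain s where s: "s \<in> S" "name s = name z" by force
    then have "\<forall>k<n. cell P ((T ^^ k) s) = cell P ((T ^^ k) z)"
      by (simp add: name_def)
    then have "dyn_dist T P n s y = dyn_dist T P n z y" for y
      unfolding dyn_dist_def by (metis (no_types, lifting))
    with s(1) show ?thesis by (intro bexI[of _ s]) (auto simp: dyn_ball_def)
  qed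
  with S that show ?thesis by blast
qed

text \<open>Replacing every centre by its representative keeps the union of balls and does not
  increase the number of centres. The value \<open>\<infinity>\<close> for sets that do not qualify makes the index
  set of the infimum independent of \<open>x\<close>.\<close>

lemma rel_complexity_countable_INF:
  assumes "S \<subseteq> space M"
    and rep: "\<And>z. z \<in> space M \<Longrightarrow> \<exists>s\<in>S. \<forall>\<epsilon>. dyn_ball M T n P s \<epsilon> = dyn_ball M T n P z \<epsilon>"
  shows "rel_complexity M T C P n \<epsilon> x =
    (INF F \<in> {F. finite F \<and> F \<subseteq> S}.
       if cond_measure M C (\<Union>z\<in>F. dyn_ball M T n P z \<epsilon>) x > 1 - \<epsilon> then enat (card F) else \<infinity>)"
    (is "_ = (INF F \<in> ?I. ?K F)")
proof (rule antisym)
  show "rel_complexity M T C P n \<epsilon> x \<le> (INF F \<in> ?I. ?K F)"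
  proof (rule INF_greatest)
    fix F assume "F \<in> ?I"
    then show "rel_complexity M T C P n \<epsilon> x \<le> ?K F"
      using assms(1) by (auto simp: rel_complexity_def intro: INF_lower)
  qed
next
  obtain \<rho> where \<rho>: "\<And>z. z \<in> space M \<Longrightarrow> \<rho> z \<in> S"
      "\<And>z. z \<in> space M \<Longrightarrow> dyn_ball M T n P (\<rho> z) \<epsilon> = dyn_ball M T n P z \<epsilon>"
    using rep by metis
  show "(INF F \<in> ?I. ?K F) \<le> rel_complexity M T C P n \<epsilon> x"
    unfolding rel_complexity_def
  proof (rule INF_greatest)
    fix F assume F: "F \<in> {F. finite F \<and> F \<subseteq> space M \<and>
       cond_measure M C (\<Union>z\<in>F. dyn_ball M T n P z \<epsilon>) x > 1 - \<epsilon>}"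
    have "(\<Union>z\<in>\<rho> ` F. dyn_ball M T n P z \<epsilon>) = (\<Union>z\<in>F. dyn_ball M T n P z \<epsilon>)"
      using F \<rho>(2) by auto
    with F have "?K (\<rho> ` F) = enat (card (\<rho> ` F))" by simp
    also have "\<dots> \<le> enat (card F)" using F by (simp add: card_image_le)
    finally show "(INF F \<in> ?I. ?K F) \<le> enat (card F)"
      using F \<rho>(1) by (intro INF_lower2[of "\<rho> ` F"]) auto
  qed
qed

lemma rel_complexity_measurable:
  assumes T: "T \<in> measurable M M" and P: "countable_measurable_partition M P"
  shows "rel_complexity M T C P n \<epsilon> \<in> measurable M (count_space UNIV)"
proof -
  obtain S where S: "countable S" "S \<subseteq> space M"
    "\<And>z. z \<in> space M \<Longrightarrow> \<exists>s\<in>S. \<forall>\<epsilon>. dyn_ball M T n P s \<epsilon> = dyn_ball M T n P z \<epsilon>"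
    by (rule countable_representatives[OF T P, of n]) blast
  have [simp]: "countable {F. finite F \<and> F \<subseteq> S}"
    using S(1) by (rule countable_Collect_finite_subset)
  have [measurable]: "cond_measure M C A \<in> borel_measurable M" for A
    unfolding cond_measure_def by measurable
  have "rel_complexity M T C P n \<epsilon> = (\<lambda>x. INF F \<in> {F. finite F \<and> F \<subseteq> S}.
       if cond_measure M C (\<Union>z\<in>F. dyn_ball M T n P z \<epsilon>) x > 1 - \<epsilon> then enat (card F) else \<infinity>)"
    using rel_complexity_countable_INF[OF S(2,3)] by auto
  also have "\<dots> \<in> measurable M (count_space UNIV)"
    by measurable
  finally show ?thesis .
qed

text \<open>Enlarging \<open>\<epsilon>\<close> enlarges the balls and lowers the threshold \<open>1 - \<epsilon>\<close>. Monotonicity of the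
  conditional measure holds only almost everywhere for each set of centres, and the countable
  index set allows a single null set for all of them.\<close>

lemma rel_complexity_antimono:
  assumes M: "prob_space M" and C: "subalgebra M C"
    and T: "T \<in> measurable M M" and P: "countable_measurable_partition M P"
    and "\<epsilon> \<le> \<epsilon>'"
  shows "AE x in M. rel_complexity M T C P n \<epsilon>' x \<le> rel_complexity M T C P n \<epsilon> x"
proof -
  interpret prob_space M by (rule M)
  interpret finite_measure_subalgebra M C by unfold_locales (rule C)
  obtain S where S: "countable S" "S \<subseteq> space M"
    "\<And>z. z \<in> space M \<Longrightarrow> \<exists>s\<in>S. \<forall>\<epsilon>. dyn_ball M T n P s \<epsilon> = dyn_ball M T n P z \<epsilon>"
    by (rule countable_representatives[OF T P, of n]) blast
  let ?U = "\<lambda>F \<epsilon>. \<Union>z\<in>F. dyn_ball M T n P z \<epsilon>"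
  have mono: "AE x in M. \<forall>F\<in>{F. finite F \<and> F \<subseteq> S}. cond_measure M C (?U F \<epsilon>) x \<le> cond_measure M C (?U F \<epsilon>') x"
  proof (rule AE_ball_countable')
    fix F assume F: "F \<in> {F. finite F \<and> F \<subseteq> S}"
    have [measurable]: "?U F \<epsilon> \<in> sets M" for \<epsilon>
      using F S(2) dyn_ball_measurable[OF T P] by (intro sets.finite_UN) auto
    have "?U F \<epsilon> \<subseteq> ?U F \<epsilon>'"
      using \<open>\<epsilon> \<le> \<epsilon>'\<close> by (force simp: dyn_ball_def)
    then have "indicator (?U F \<epsilon>) x \<le> (indicator (?U F \<epsilon>') x :: real)" for x
      by (auto simp: indicator_def)
    then show "AE x in M. cond_measure M C (?U F \<epsilon>) x \<le> cond_measure M C (?U F \<epsilon>') x"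
      unfolding cond_measure_def
      by (intro real_cond_exp_mono AE_I2) (simp_all add: less_top[symmetric])
  qed (use S(1) countable_Collect_finite_subset in blast)
  have INF_eq: "rel_complexity M T C P n \<epsilon> x = (INF F \<in> {F. finite F \<and> F \<subseteq> S}.
      if cond_measure M C (?U F \<epsilon>) x > 1 - \<epsilon> then enat (card F) else \<infinity>)" for \<epsilon> x
    using S(2,3) by (rule rel_complexity_countable_INF)
  from mono show ?thesis
  proof eventually_elim
    case (elim x)
    show ?case
      unfolding INF_eq
    proof (rule INF_mono)
      fix F assume F: "F \<in> {F. finite F \<and> F \<subseteq> S}"
      then have "1 - \<epsilon>' < cond_measure M C (?U F \<epsilon>') x" if "1 - \<epsilon> < cond_measure M C (?U F \<epsilon>) x"
        using elim that \<open>\<epsilon> \<le> \<epsilon>'\<close> by fastforce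
      with F show "\<exists>G\<in>{F. finite F \<and> F \<subseteq> S}.
          (if cond_measure M C (?U G \<epsilon>') x > 1 - \<epsilon>' then enat (card G) else \<infinity>) \<le>
          (if cond_measure M C (?U F \<epsilon>) x > 1 - \<epsilon> then enat (card F) else \<infinity>)"
        by (intro bexI[of _ F]) simp_all
    qed
  qed
qed

text \<open>Monotonicity extends to the argument \<open>0\<close>, because \<open>log_enat 0 = 0\<close>.\<close>

lemma log_enat_mono: "a \<le> b \<Longrightarrow> log_enat a \<le> log_enat b"
proof (cases a; cases b)
  fix i j assume "a \<le> b" "a = enat i" "b = enat j"
  then show ?thesis
    by (cases "i = 0") (auto simp: log_enat_def intro!: ennreal_leI)
qed (auto simp: log_enat_def)

theorem proposition1:
  fixes M C :: "'a measure" and T :: "'a \<Rightarrow> 'a" and P :: "'a set set"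
    and d :: "nat \<Rightarrow> real" and n :: "nat \<Rightarrow> nat"
  assumes "ppt M T"
    and "factor M T C"
    and "countable_measurable_partition M P"
    and "\<And>k. d k > 0"
    and "\<And>k. n k > 0"
    and "filterlim n at_top sequentially"
  shows "\<exists>(\<kappa> :: nat \<Rightarrow> nat) (N :: ennreal measure) (Y :: ennreal \<Rightarrow> ennreal).
    strict_mono \<kappa> \<and> prob_space N \<and>
    double_conv_in_distribution M
      (\<lambda>l \<epsilon> x. log_enat (rel_complexity M T C P (n (\<kappa> l)) \<epsilon> x) / ennreal (d (\<kappa> l))) N Y"
proof -
  have M: "prob_space M" and T: "T \<in> measurable M M"
    using assms(1) by (auto simp: ppt_def)
  have C: "subalgebra M C" using assms(2) by (simp add: factor_def)
  let ?Z = "\<lambda>k \<epsilon> x. log_enat (rel_complexity M T C P (n k) \<epsilon> x) / ennreal (d k)"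
  show ?thesis
  proof (rule monotone_family_converges_along_subsequence[OF M, of ?Z])
    fix k and \<epsilon> :: real
    have "(\<lambda>N. log_enat N / ennreal (d k)) \<in> measurable (count_space UNIV) borel" by simp
    from measurable_compose[OF rel_complexity_measurable[OF T assms(3)] this]
    show "?Z k \<epsilon> \<in> borel_measurable M" .
  next
    fix k and \<epsilon> \<epsilon>' :: real assume "\<epsilon> \<le> \<epsilon>'"
    from rel_complexity_antimono[OF M C T assms(3) this, of "n k"]
    show "AE x in M. ?Z k \<epsilon>' x \<le> ?Z k \<epsilon> x"
      by eventually_elim (rule divide_right_mono_ennreal[OF log_enat_mono])
  qed
qed

end
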